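(* Let $\Lambda$ be a multiset of four complex numbers. The following are equivalent: (1) there is a trace-preserving completely positive linear map $T:\mathcal{M}_2(\mathbb{C})\to\mathcal{M}_2(\mathbb{C})$ with $\mathrm{spec}(T)=\Lambda$; (2) there is a unital, trace-preserving, completely positive linear map $T:\mathcal{M}_2(\mathbb{C})\to\mathcal{M}_2(\mathbb{C})$ with $\mathrm{spec}(T)=\Lambda$; (3) $\Lambda=\{1\}\cup\{\lambda_1,\lambda_2,\lambda_3\}$ where the multiset $\{\lambda_1,\lambda_2,\lambda_3\}$ is closed under complex conjugation, and the vector $s\in\mathbb{R}^3$ defined by $s_i:=\lambda_i$ if $\lambda_i\in\mathbb{R}$ and $s_i:=|\lambda_i|$ otherwise satisfies $s\in\mathcal{T}$.
   Context: $\mathcal{T}\subset\mathbb{R}^3$ is the closed tetrahedron with vertices $(1,1,1),(1,-1,-1),(-1,1,-1),(-1,-1,1)$ (the points with coordinates $\pm1$ and product $1$). Equivalently, with the components of $s$ ordered after sign adjustments as $s_1\ge s_2\ge|s_3|$ (flipping an even number of signs), $s\in\mathcal{T}$ iff $s_1\le1$ and $s_1+s_2\le 1+s_3$. A linear map $T$ on $\mathcal{M}_d(\mathbb{C})$ is completely positive if $T\otimes\mathrm{id}_d$ maps positive semidefinite matrices to positive semidefinite matrices, trace-preserving if $\mathrm{tr}[T(X)]=\mathrm{tr}[X]$, unital if $T(\mathbbm{1})=\mathbbm{1}$. $\mathrm{spec}(T)$ is the spectrum of $T$ as a linear operator on $\mathcal{M}_d(\mathbb{C})$, counted with algebraic multiplicity.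 *)

theory Defs
  imports "HOL-Analysis.Analysis" "Jordan_Normal_Form.Char_Poly"
begin

definition lin_map_M2 :: "(complex mat \<Rightarrow> complex mat) \<Rightarrow> bool" where
  "lin_map_M2 T \<longleftrightarrow>
     (\<forall>A \<in> carrier_mat 2 2. T A \<in> carrier_mat 2 2) \<and>
     (\<forall>A \<in> carrier_mat 2 2. \<forall>B \<in> carrier_mat 2 2. T (A + B) = T A + T B) \<and>
     (\<forall>A \<in> carrier_mat 2 2. \<forall>c. T (c \<cdot>\<^sub>m A) = c \<cdot>\<^sub>m T A)"

definition psd_mat :: "nat \<Rightarrow> complex mat \<Rightarrow> bool" where
  "psd_mat n A \<longleftrightarrow> A \<in> carrier_mat n n \<and>
     (\<forall>v \<in> carrier_vec n. scalar_prod (map_vec cnj v) (A *\<^sub>v v) \<in> \<real> \<and> 0 \<le> Re (scalar_prod (map_vec cnj v) (A *\<^sub>v v)))"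

text \<open>T \<otimes> id_2 acting on M_2 \<otimes> M_2 = M_4 (Kronecker ordering: row index 2*i+a with
  i the index of the first factor, a of the second).\<close>
definition tensor_id2 :: "(complex mat \<Rightarrow> complex mat) \<Rightarrow> complex mat \<Rightarrow> complex mat" where
  "tensor_id2 T X = mat 4 4 (\<lambda>(r, c).
      T (mat 2 2 (\<lambda>(i, j). X $$ (2 * i + r mod 2, 2 * j + c mod 2))) $$ (r div 2, c div 2))"

definition completely_positive :: "(complex mat \<Rightarrow> complex mat) \<Rightarrow> bool" where
  "completely_positive T \<longleftrightarrow> (\<forall>X. psd_mat 4 X \<longrightarrow> psd_mat 4 (tensor_id2 T X))"

definition mat_trace :: "complex mat \<Rightarrow> complex" where
  "mat_trace A = (\<Sum>i < dim_row A. A $$ (i, i))"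

definition trace_preserving :: "(complex mat \<Rightarrow> complex mat) \<Rightarrow> bool" where
  "trace_preserving T \<longleftrightarrow> (\<forall>A \<in> carrier_mat 2 2. mat_trace (T A) = mat_trace A)"

definition unital :: "(complex mat \<Rightarrow> complex mat) \<Rightarrow> bool" where
  "unital T \<longleftrightarrow> T (1\<^sub>m 2) = 1\<^sub>m 2"

definition unit_M2 :: "nat \<Rightarrow> complex mat" where
  "unit_M2 k = mat 2 2 (\<lambda>(i, j). if i = k div 2 \<and> j = k mod 2 then 1 else 0)"

definition op_matrix :: "(complex mat \<Rightarrow> complex mat) \<Rightarrow> complex mat" where
  "op_matrix T = mat 4 4 (\<lambda>(r, k). T (unit_M2 k) $$ (r div 2, r mod 2))"

definition spec_op :: "(complex mat \<Rightarrow> complex mat) \<Rightarrow> complex multiset" where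
  "spec_op T = proots (char_poly (op_matrix T))"

definition tetrahedron :: "(real \<times> real \<times> real) set" where
  "tetrahedron = convex hull {(1, 1, 1), (1, -1, -1), (-1, 1, -1), (-1, -1, 1)}"

definition sval :: "complex \<Rightarrow> real" where
  "sval z = (if z \<in> \<real> then Re z else cmod z)"

end

theory Submission
  imports Defs
begin

text \<open>
  In the Pauli basis a trace-preserving $T$ is block triangular with diagonal blocks $1$ and a real $3 \times 3$
  matrix, whose transpose is called $D$ below. Evaluating the positive Choi form of $T$ at the vector of
  $U = w - i(x\sigma_1 + y\sigma_2 + z\sigma_3)$ gives a real quadratic form in $(w, x, y, z)$ that depends on $D$
  only, so the non-unital part of $T$ plays no role. At $U = 1$ it yields $1 + \mathrm{tr}\, D \ge 0$, and at an
  eigenvector of $D$ for $\mu$ (real and imaginary parts added) it yields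
  $1 - \mathrm{tr}\, D + 2\, \mathrm{Re}\, \mu \ge 0$. If all eigenvalues are real, these are exactly the four faces of
  the tetrahedron. For a non-real $\mu$ with eigenvector $u + iv$ the form on the span of $1$ and $u \times v$ has a
  discriminant that gives the remaining bound on $|\mu|$.

  Conversely every admissible spectrum is realised by a unital map acting by a real doubly stochastic matrix on the
  diagonal and by $\mathbb{R}$-linear maps $c \mapsto a c + b \bar c$ on the off-diagonal entry of Hermitian matrices.
\<close>

section \<open>The tetrahedron as an intersection of four half-spaces\<close>

text \<open>The half-spaces are convex and contain the vertices, so they contain the hull.
  Conversely the four affine expressions, divided by 4, are the barycentric coordinates of the
  point.\<close>

lemma tetrahedron_iff:
  "(s1, s2, s3) \<in> tetrahedron \<longleftrightarrow>
     0 \<le> 1 + s1 + s2 + s3 \<and> 0 \<le> 1 + s1 - s2 - s3 \<and> 0 \<le> 1 - s1 + s2 - s3 \<and> 0 \<le> 1 - s1 - s2 + s3"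
    (is "_ \<longleftrightarrow> ?R")
proof
  let ?H = "{(a, b, c). 0 \<le> 1 + a + b + c \<and> 0 \<le> 1 + a - b - c \<and> 0 \<le> 1 - a + b - c \<and> 0 \<le> 1 - a - b + (c::real)}"
  have "convex ?H"
  proof (rule convexI)
    fix x y :: "real \<times> real \<times> real" and u v :: real
    assume xy: "x \<in> ?H" "y \<in> ?H" and uv: "0 \<le> u" "0 \<le> v" "u + v = 1"
    obtain a b c a' b' c' where [simp]: "x = (a, b, c)" "y = (a', b', c')"
      by (metis prod_cases3)
    have mix: "0 \<le> u * p + v * q" if "0 \<le> p" "0 \<le> q" for p q :: real
      using that uv by simp
    have "v = 1 - u" using uv by simp
    then show "u *\<^sub>R x + v *\<^sub>R y \<in> ?H"
      using xy mix[of "1 + a + b + c" "1 + a' + b' + c'"] mix[of "1 + a - b - c" "1 + a' - b' - c'"]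
        mix[of "1 - a + b - c" "1 - a' + b' - c'"] mix[of "1 - a - b + c" "1 - a' - b' + c'"]
      by (simp add: algebra_simps)
  qed
  then have "tetrahedron \<subseteq> ?H"
    unfolding tetrahedron_def by (intro hull_minimal) auto
  then show "(s1, s2, s3) \<in> tetrahedron \<Longrightarrow> ?R" by auto
next
  assume R: ?R
  \<comment> \<open>The weight of a vertex \<open>x\<close> is (1 + <x, s>) / 4, so each face
    inequality says that one weight is nonnegative.\<close>
  define u where "u = (\<lambda>(a, b, c). (1 + a * s1 + b * s2 + c * s3) / 4)"
  have "(\<forall>x\<in>{(1, 1, 1), (1, -1, -1), (-1, 1, -1), (-1, -1, 1)}. 0 \<le> u x)
      \<and> sum u {(1, 1, 1), (1, -1, -1), (-1, 1, -1), (-1, -1, 1)} = 1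
      \<and> (\<Sum>x\<in>{(1, 1, 1), (1, -1, -1), (-1, 1, -1), (-1, -1, 1)}. u x *\<^sub>R x) = (s1, s2, s3)"
    using R by (simp add: u_def field_simps)
  then show "(s1, s2, s3) \<in> tetrahedron"
    unfolding tetrahedron_def by (subst convex_hull_finite) (simp, blast)
qed

section \<open>Eigenvalue bounds from a positive quadratic form\<close>

text \<open>With eigenvector u + iv, n = u x v, L = |n|^2 and N = |u|^2 + |v|^2, the form restricted
  to the span of 1 and n has off-diagonal coefficient (Im m) N. Since N^2 >= 4 L, its discriminant
  inequality carries a factor L on both sides, and cancelling it gives the second bound.\<close>

lemma eigenvalue_bounds:
  fixes d11 d12 d13 d21 d22 d23 d31 d32 d33 :: real and m x1 x2 x3 :: complex
  defines "t \<equiv> d11 + d22 + d33"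
  assumes K: "\<And>w x y z :: real. 0 \<le> w\<^sup>2 + x\<^sup>2 + y\<^sup>2 + z\<^sup>2 + (w\<^sup>2 - x\<^sup>2 - y\<^sup>2 - z\<^sup>2) * t
      + 2 * (x * (d11 * x + d12 * y + d13 * z) + y * (d21 * x + d22 * y + d23 * z) + z * (d31 * x + d32 * y + d33 * z))
      + 2 * w * (x * (d23 - d32) + y * (d31 - d13) + z * (d12 - d21))"
    and ev: "d11 * x1 + d12 * x2 + d13 * x3 = m * x1"
      "d21 * x1 + d22 * x2 + d23 * x3 = m * x2"
      "d31 * x1 + d32 * x2 + d33 * x3 = m * x3"
    and nz: "x1 \<noteq> 0 \<or> x2 \<noteq> 0 \<or> x3 \<noteq> 0"
  shows "0 \<le> 1 - t + 2 * Re m"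
    and "Im m \<noteq> 0 \<Longrightarrow> 4 * (Im m)\<^sup>2 \<le> (1 + t) * (1 + t - 4 * Re m)"
proof -
  define u1 u2 u3 v1 v2 v3 a b where defs: "u1 = Re x1" "u2 = Re x2" "u3 = Re x3"
    "v1 = Im x1" "v2 = Im x2" "v3 = Im x3" "a = Re m" "b = Im m"
  have U: "d11 * u1 + d12 * u2 + d13 * u3 = a * u1 - b * v1"
      "d21 * u1 + d22 * u2 + d23 * u3 = a * u2 - b * v2"
      "d31 * u1 + d32 * u2 + d33 * u3 = a * u3 - b * v3"
   and V: "d11 * v1 + d12 * v2 + d13 * v3 = a * v1 + b * u1"
      "d21 * v1 + d22 * v2 + d23 * v3 = a * v2 + b * u2"
      "d31 * v1 + d32 * v2 + d33 * v3 = a * v3 + b * u3"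
    using ev by (auto simp: defs complex_eq_iff)
  define N where "N = (u1\<^sup>2 + u2\<^sup>2 + u3\<^sup>2) + (v1\<^sup>2 + v2\<^sup>2 + v3\<^sup>2)"
  have N: "N > 0"
    using nz unfolding N_def defs
    by (auto simp: complex_eq_iff add_nonneg_eq_0_iff less_le intro!: add_nonneg_nonneg)
  \<comment> \<open>The mixed terms in \<open>b\<close> cancel when the values at u and at v are
    added.\<close>
  have "0 \<le> N * (1 - t + 2 * a)"
    using K[of 0 u1 u2 u3] K[of 0 v1 v2 v3] unfolding U V N_def
    by (simp add: power2_eq_square algebra_simps)
  then show "0 \<le> 1 - t + 2 * Re m"
    using N by (simp add: zero_le_mult_iff defs)
  define n1 n2 n3 where n: "n1 = u2 * v3 - u3 * v2" "n2 = u3 * v1 - u1 * v3" "n3 = u1 * v2 - u2 * v1"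
  define L where "L = n1\<^sup>2 + n2\<^sup>2 + n3\<^sup>2"
  define c where "c = n1 * (d23 - d32) + n2 * (d31 - d13) + n3 * (d12 - d21)"
  \<comment> \<open>Pairing n with the antisymmetric part of the matrix d gives u.dv - v.du.\<close>
  have c: "c = b * N"
  proof -
    have "c = u1 * (d11 * v1 + d12 * v2 + d13 * v3) + u2 * (d21 * v1 + d22 * v2 + d23 * v3) + u3 * (d31 * v1 + d32 * v2 + d33 * v3)
      - (v1 * (d11 * u1 + d12 * u2 + d13 * u3) + v2 * (d21 * u1 + d22 * u2 + d23 * u3) + v3 * (d31 * u1 + d32 * u2 + d33 * u3))"
      unfolding c_def n by (simp add: algebra_simps)
    then show ?thesis unfolding U V N_def by (simp add: algebra_simps power2_eq_square)
  qed
  \<comment> \<open>The span of u and v is invariant with trace 2a, so n, normal to it, is a left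
    eigenvector for the remaining eigenvalue t - 2a. The proof avoids dividing by L through
    det(dn,u,v) + det(n,du,v) + det(n,u,dv) = t det(n,u,v), where det(n,u,v) = L.\<close>
  have q: "n1 * (d11 * n1 + d12 * n2 + d13 * n3) + n2 * (d21 * n1 + d22 * n2 + d23 * n3) + n3 * (d31 * n1 + d32 * n2 + d33 * n3)
     = (t - 2 * a) * L"
  proof -
    have "n1 * (d11 * n1 + d12 * n2 + d13 * n3) + n2 * (d21 * n1 + d22 * n2 + d23 * n3) + n3 * (d31 * n1 + d32 * n2 + d33 * n3)
      + (n1 * ((d21 * u1 + d22 * u2 + d23 * u3) * v3 - (d31 * u1 + d32 * u2 + d33 * u3) * v2)
       + n2 * ((d31 * u1 + d32 * u2 + d33 * u3) * v1 - (d11 * u1 + d12 * u2 + d13 * u3) * v3)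
       + n3 * ((d11 * u1 + d12 * u2 + d13 * u3) * v2 - (d21 * u1 + d22 * u2 + d23 * u3) * v1))
      + (n1 * ((d31 * v1 + d32 * v2 + d33 * v3) * u2 - (d21 * v1 + d22 * v2 + d23 * v3) * u3)
       + n2 * ((d11 * v1 + d12 * v2 + d13 * v3) * u3 - (d31 * v1 + d32 * v2 + d33 * v3) * u1)
       + n3 * ((d21 * v1 + d22 * v2 + d23 * v3) * u1 - (d11 * v1 + d12 * v2 + d13 * v3) * u2)) = t * L"
      unfolding t_def L_def n by (simp add: algebra_simps power2_eq_square)
    then show ?thesis unfolding U V L_def n by (simp add: algebra_simps power2_eq_square)
  qed
  assume "Im m \<noteq> 0"
  then have b: "b \<noteq> 0" by (simp add: defs)
  have NL: "4 * L \<le> N\<^sup>2"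
  proof -
    \<comment> \<open>Lagrange's identity for |u x v|^2, followed by completing the square.\<close>
    have "N\<^sup>2 - 4 * L = ((u1\<^sup>2 + u2\<^sup>2 + u3\<^sup>2) - (v1\<^sup>2 + v2\<^sup>2 + v3\<^sup>2))\<^sup>2 + 4 * (u1 * v1 + u2 * v2 + u3 * v3)\<^sup>2"
      unfolding N_def L_def n by (simp add: algebra_simps power2_eq_square)
    then show ?thesis by (smt (verit) zero_le_power2)
  qed
  have form: "0 \<le> w\<^sup>2 * (1 + t) + 2 * w * y * c + y\<^sup>2 * (L * (1 + t - 4 * a))" for w y
  proof -
    have "0 \<le> w\<^sup>2 + (y * n1)\<^sup>2 + (y * n2)\<^sup>2 + (y * n3)\<^sup>2 + (w\<^sup>2 - (y * n1)\<^sup>2 - (y * n2)\<^sup>2 - (y * n3)\<^sup>2) * t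
      + 2 * y\<^sup>2 * (n1 * (d11 * n1 + d12 * n2 + d13 * n3) + n2 * (d21 * n1 + d22 * n2 + d23 * n3) + n3 * (d31 * n1 + d32 * n2 + d33 * n3))
      + 2 * w * y * c"
      using K[of w "y * n1" "y * n2" "y * n3"] unfolding c_def by (simp add: algebra_simps power2_eq_square)
    then show ?thesis unfolding q L_def by (simp add: algebra_simps power2_eq_square)
  qed
  have disc: "c\<^sup>2 \<le> (1 + t) * (L * (1 + t - 4 * a))"
  proof (cases "1 + t = 0")
    case True
    have "c = 0"
    proof (rule ccontr)
      assume "c \<noteq> 0"
      let ?e = "L * (1 + t - 4 * a)"
      \<comment> \<open>Without its w^2 term the form at y = 1 is affine in w; at this w it equals
        -1.\<close>
      show False using form[of "- (?e + 1) / (2 * c)" 1] True \<open>c \<noteq> 0\<close> by (simp add: field_simps)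
    qed
    then show ?thesis using True by simp
  next
    case False
    moreover have "0 \<le> 1 + t" using form[of 1 0] by simp
    ultimately have "0 < 1 + t" by simp
    \<comment> \<open>The point (-c, 1 + t) minimises the form up to scaling, and its value there is
      1 + t times the negated discriminant (up to a factor 4).\<close>
    have "0 \<le> (1 + t) * ((1 + t) * (L * (1 + t - 4 * a)) - c\<^sup>2)"
      using form[of "-c" "1 + t"] by (simp add: algebra_simps power2_eq_square)
    then show ?thesis using \<open>0 < 1 + t\<close> by (simp add: zero_le_mult_iff)
  qed
  have c2: "c\<^sup>2 = b\<^sup>2 * N\<^sup>2" using c by (simp add: power_mult_distrib)
  have "b\<^sup>2 * (4 * L) \<le> b\<^sup>2 * N\<^sup>2" using NL by (intro mult_left_mono) auto
  also have "\<dots> \<le> (1 + t) * (L * (1 + t - 4 * a))" using disc c2 by simp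
  finally have le: "L * (4 * b\<^sup>2) \<le> L * ((1 + t) * (1 + t - 4 * a))" by (simp add: algebra_simps)
  have "L \<noteq> 0"
  proof
    assume "L = 0"
    then have "n1 = 0" "n2 = 0" "n3 = 0" unfolding L_def
      by (simp_all add: add_nonneg_eq_0_iff)
    then have "c = 0" by (simp add: c_def)
    then show False using c b N by simp
  qed
  moreover have "0 \<le> L" by (simp add: L_def)
  ultimately show "4 * (Im m)\<^sup>2 \<le> (1 + t) * (1 + t - 4 * Re m)"
    using le by (simp add: defs)
qed

section \<open>Conjugation-closed triples and the tetrahedron condition\<close>

text \<open>The three faces with two minus signs have the form 1 - sum + 2 s. This version depends
  on the multiset only, so eigenvalues may be reordered freely.\<close>

lemma tetrahedron_iff_mset:
  "(s1, s2, s3) \<in> tetrahedron \<longleftrightarrow>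
     0 \<le> 1 + \<Sum>\<^sub># {#s1, s2, s3#} \<and> (\<forall>s \<in># {#s1, s2, s3#}. 0 \<le> 1 - \<Sum>\<^sub># {#s1, s2, s3#} + 2 * s)"
  unfolding tetrahedron_iff by (auto simp: algebra_simps)

text \<open>A non-real z is distinct from its conjugate, which is also a member; the one element
  left after removing both is fixed by conjugation, hence real.\<close>

lemma cnj_closed_triple:
  assumes cl: "image_mset cnj {#l1, l2, l3#} = {#l1, l2, l3#}" and nr: "\<exists>l \<in># {#l1, l2, l3#}. l \<notin> \<real>"
  obtains z x where "{#l1, l2, l3#} = {#z, cnj z, complex_of_real x#}" "z \<notin> \<real>"
proof -
  obtain z b c where z: "{#l1, l2, l3#} = {#z, b, c#}" "z \<notin> \<real>"
    using nr by simp (metis add_mset_commute)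
  have cl': "image_mset cnj {#z, b, c#} = {#z, b, c#}"
    using cl unfolding z .
  then have "cnj z \<in># {#z, b, c#}"
    by (metis image_mset_add_mset union_single_eq_member)
  moreover have "cnj z \<noteq> z" using z(2) by (simp add: Reals_cnj_iff)
  ultimately obtain d where d: "{#z, b, c#} = {#z, cnj z, d#}"
    by (auto simp: add_mset_commute)
  then have "image_mset cnj {#z, cnj z, d#} = {#z, cnj z, d#}"
    using cl' by simp
  then have "cnj d = d" by (simp add: add_mset_commute)
  then have "d = complex_of_real (Re d)" by (simp add: Reals_cnj_iff)
  then show ?thesis using that z d by metis
qed

text \<open>At (|z|, |z|, x) two faces coincide in x <= 1, one is 2|z| <= 1 + x, and the fourth
  follows from the latter.\<close>

lemma sval_pair_tetrahedron_iff:
  assumes "{#l1, l2, l3#} = {#z, cnj z, complex_of_real x#}" "z \<notin> \<real>"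
  shows "(sval l1, sval l2, sval l3) \<in> tetrahedron \<longleftrightarrow> x \<le> 1 \<and> 2 * cmod z \<le> 1 + x"
proof -
  have "cnj z \<notin> \<real>" using assms(2) by (simp add: complex_is_Real_iff)
  then have "{#sval l1, sval l2, sval l3#} = {#cmod z, cmod z, x#}"
    using arg_cong[OF assms(1), of "image_mset sval"] assms(2) by (simp add: sval_def)
  then have "(sval l1, sval l2, sval l3) \<in> tetrahedron \<longleftrightarrow> (cmod z, cmod z, x) \<in> tetrahedron"
    unfolding tetrahedron_iff_mset by simp
  also have "\<dots> \<longleftrightarrow> x \<le> 1 \<and> 2 * cmod z \<le> 1 + x"
    unfolding tetrahedron_iff using norm_ge_zero[of z] by (auto simp del: norm_ge_zero)
  finally show ?thesis .
qed

section \<open>Positive semidefinite 4 x 4 matrices and the Choi matrix\<close>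

text \<open>Vectors are functions on the naturals, so test vectors can be written down without
  carrier conditions.\<close>

definition herm_form :: "complex mat \<Rightarrow> (nat \<Rightarrow> complex) \<Rightarrow> complex" where
  "herm_form A v = (\<Sum>i<4. \<Sum>j<4. cnj (v i) * A $$ (i, j) * v j)"

lemma sum_less_4: "(\<Sum>i<4. f i) = f 0 + f (Suc 0) + f 2 + f 3" for f :: "nat \<Rightarrow> 'a::comm_monoid_add"
  by (simp add: eval_nat_numeral)

lemma psd_mat_4_iff:
  "psd_mat 4 A \<longleftrightarrow> A \<in> carrier_mat 4 4 \<and> (\<forall>v. herm_form A v \<in> \<real> \<and> 0 \<le> Re (herm_form A v))"
proof -
  have form: "scalar_prod (map_vec cnj v) (A *\<^sub>v v) = herm_form A (\<lambda>i. v $ i)"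
    if "A \<in> carrier_mat 4 4" "v \<in> carrier_vec 4" for v
    using that by (auto simp: scalar_prod_def herm_form_def row_def atLeast0LessThan sum_distrib_left mult.assoc)
  have cong: "herm_form A v = herm_form A (\<lambda>i. vec 4 v $ i)" for v
    unfolding herm_form_def by (intro sum.cong) auto
  show ?thesis
    unfolding psd_mat_def
    by (metis form cong vec_carrier)
qed

text \<open>Polarisation: a form with only real values comes from a Hermitian matrix.\<close>

lemma psd_mat_4_herm:
  assumes "psd_mat 4 A" "i < 4" "j < 4"
  shows "A $$ (j, i) = cnj (A $$ (i, j))"
proof -
  have real: "Im (herm_form A v) = 0" for v
    using assms(1) unfolding psd_mat_4_iff by (auto simp: complex_is_Real_iff)
  have less_4: "k < 4 \<longleftrightarrow> k = 0 \<or> k = Suc 0 \<or> k = 2 \<or> k = 3" for k :: nat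
    by auto
  have sum1: "herm_form A (\<lambda>k. if k = i then 1 else 0) = A $$ (i, i)" if "i < 4" for i
    using that unfolding less_4 by (elim disjE; simp add: herm_form_def sum_less_4)
  have ij: "herm_form A (\<lambda>k. if k = i then 1 else if k = j then a else 0)
      = A $$ (i, i) + cnj a * a * A $$ (j, j) + a * A $$ (i, j) + cnj a * A $$ (j, i)" if "i \<noteq> j" for a
    using assms(2,3) that unfolding less_4
    by (elim disjE; simp add: herm_form_def sum_less_4 algebra_simps)
  have diag: "Im (A $$ (k, k)) = 0" if "k < 4" for k
    using real[of "\<lambda>j. if j = k then 1 else 0"] sum1[OF that] by simp
  show ?thesis
  proof (cases "i = j")
    case True
    then show ?thesis using diag assms by (simp add: complex_eq_iff)
  next
    case False
    \<comment> \<open>The vector e_i + e_j settles the imaginary parts, and e_i + \<i> e_j the real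
      parts.\<close>
    show ?thesis
      using real[of "\<lambda>k. if k = i then 1 else if k = j then 1 else 0"]
        real[of "\<lambda>k. if k = i then 1 else if k = j then \<i> else 0"] diag assms(2,3)
      unfolding ij[OF False] by (simp add: complex_eq_iff)
  qed
qed

text \<open>\<open>C\<close> is the Choi matrix: applying T to the blocks of the unnormalised
  maximally entangled state yields the images of the matrix units. Hence \<open>C\<close> has the
  entries of \<open>op_matrix T\<close> with the two middle index bits exchanged.\<close>

lemma Choi_matrix_entry:
  fixes T :: "complex mat \<Rightarrow> complex mat"
  defines "M \<equiv> op_matrix T"
  defines "C \<equiv> tensor_id2 T (mat 4 4 (\<lambda>(r, c). if (r = 0 \<or> r = 3) \<and> (c = 0 \<or> c = 3) then 1 else 0))"
  assumes "k < 2" "l < 2" "a < 2" "b < 2"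
  shows "C $$ (2 * k + a, 2 * l + b) = M $$ (2 * k + l, 2 * a + b)"
proof -
  have "mat 2 2 (\<lambda>(i, j). mat 4 4 (\<lambda>(r, c). if (r = 0 \<or> r = 3) \<and> (c = 0 \<or> c = 3) then 1 else 0) $$ (2 * i + a, 2 * j + b)) 
      = unit_M2 (2 * a + b)" 
    using assms(5,6) by (auto simp: unit_M2_def less_2_cases_iff intro!: eq_matI)
  then show ?thesis
  using assms(3-6) unfolding C_def M_def tensor_id2_def op_matrix_def
  by (simp add: mod_mult_self4)
qed

text \<open>The matrix has rank one, and its form is |v_0 + v_3|^2.\<close>

lemma psd_maximally_entangled:
  "psd_mat 4 (mat 4 4 (\<lambda>(r, c). if (r = 0 \<or> r = 3) \<and> (c = 0 \<or> c = 3) then 1 else 0))"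
proof -
  let ?A = "mat 4 4 (\<lambda>(r, c). if (r = 0 \<or> r = 3) \<and> (c = 0 \<or> c = 3) then 1 else 0) :: complex mat"
  have "herm_form ?A v = cnj (v 0 + v 3) * (v 0 + v 3)" for v
    by (simp add: herm_form_def sum_less_4 algebra_simps)
  then have "herm_form ?A v = complex_of_real ((cmod (v 0 + v 3))\<^sup>2)" for v
    by (simp only: complex_norm_square mult.commute)
  then show ?thesis
    unfolding psd_mat_4_iff by simp
qed

section \<open>A family of unital completely positive maps\<close>

text \<open>Complex-linear extension of c -> a c + b cnj c on the off-diagonal entry of a Hermitian
  matrix. On matrix units the operator splits into the blocks [p q; q p] and
  [a b; cnj b, cnj a].\<close>

definition mixing_map :: "complex \<Rightarrow> complex \<Rightarrow> complex \<Rightarrow> complex \<Rightarrow> complex mat \<Rightarrow> complex mat" where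
  "mixing_map p q a b A = mat 2 2 (\<lambda>(i, j).
     if i = j then p * A $$ (i, i) + q * A $$ (1 - i, 1 - i)
     else if i = 0 then a * A $$ (0, 1) + b * A $$ (1, 0)
     else cnj a * A $$ (1, 0) + cnj b * A $$ (0, 1))"

lemma lin_map_mixing_map: "lin_map_M2 (mixing_map p q a b)"
  by (auto simp: lin_map_M2_def mixing_map_def algebra_simps intro!: eq_matI)

lemma unital_mixing_map: "p + q = 1 \<Longrightarrow> unital (mixing_map p q a b)"
  by (auto simp: unital_def mixing_map_def add.commute intro!: eq_matI)

lemma trace_preserving_mixing_map:
  assumes "p + q = 1"
  shows "trace_preserving (mixing_map p q a b)"
proof -
  have "q = 1 - p" using assms by (simp add: algebra_simps)
  then have "p * x + q * y + (p * y + q * x) = x + y" for x y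
    unfolding \<open>q = 1 - p\<close> by (simp add: algebra_simps)
  then show ?thesis
    by (simp add: trace_preserving_def mixing_map_def mat_trace_def eval_nat_numeral)
qed

text \<open>The phase has modulus 1 even for a = 0, where \<open>sgn a\<close> would vanish.\<close>

lemma phase_decomp: obtains u :: complex where "a = complex_of_real (cmod a) * u" "cnj u * u = 1"
proof (cases "a = 0")
  case True
  then show ?thesis using that[of 1] by simp
next
  case False
  show ?thesis
  proof (rule that[of "sgn a"])
    show "a = complex_of_real (cmod a) * sgn a" by (simp add: sgn_eq False)
    show "cnj (sgn a) * sgn a = 1"
      using False by (simp add: complex_norm_square[symmetric] mult.commute norm_sgn)
  qed
qed

text \<open>A Kraus decomposition at the level of forms: the form of the image at v is a combination
  of forms of \<open>X\<close> at six transformed vectors, with coefficients |a|, p - |a|, |b| and q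
  - |b|, all nonnegative by assumption.\<close>

lemma completely_positive_mixing_map:
  fixes p q :: real
  assumes "cmod a \<le> p" "cmod b \<le> q"
  shows "completely_positive (mixing_map p q a b)"
  unfolding completely_positive_def
proof (intro allI impI)
  fix X assume X: "psd_mat 4 X"
  obtain e where e: "a = complex_of_real (cmod a) * e" "cnj e * e = 1" by (rule phase_decomp)
  obtain f where f: "b = complex_of_real (cmod b) * f" "cnj f * f = 1" by (rule phase_decomp)
  define Y where "Y = tensor_id2 (mixing_map p q a b) X"
  have Y: "Y \<in> carrier_mat 4 4" by (simp add: Y_def tensor_id2_def)
  \<comment> \<open>\<open>F A u i j w\<close> is the sesquilinear form of the 2 x 2 block (i, j) of
    \<open>A\<close>. \<open>P\<close> glues two scaled halves into one vector, and \<open>h\<close>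
    extracts the second half.\<close>
  define F where "F A u i j w = (\<Sum>k<2. \<Sum>l<2. cnj (u k) * A $$ (2 * i + k, 2 * j + l) * w l)"
    for A :: "complex mat" and u w :: "nat \<Rightarrow> complex" and i j
  define G where "G = F X"
  define P where "P x u y w = (\<lambda>i. if i < 2 then x * u i else y * w (i - 2))"
    for x y :: complex and u w :: "nat \<Rightarrow> complex"
  define h where "h v = (\<lambda>i. v (i + 2))" for v :: "nat \<Rightarrow> complex"
  have P: "herm_form X (P x u y w) = cnj x * x * G u 0 0 u + cnj x * y * G u 0 1 w
      + cnj y * x * G w 1 0 u + cnj y * y * G w 1 1 w" for x u y w
    unfolding herm_form_def P_def G_def F_def by (simp add: sum_less_4 numeral_2_eq_2 numeral_3_eq_3 algebra_simps)
  have H: "herm_form A v = F A v 0 0 v + F A v 0 1 (h v) + F A (h v) 1 0 v + F A (h v) 1 1 (h v)" for A v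
    unfolding herm_form_def F_def h_def by (simp add: sum_less_4 numeral_2_eq_2 numeral_3_eq_3 algebra_simps)
  have lin: "F Y u i j w = c * F X u i' j' w + d * F X u i'' j'' w"
    if "\<And>k l. k < 2 \<Longrightarrow> l < 2 \<Longrightarrow>
      Y $$ (2 * i + k, 2 * j + l) = c * X $$ (2 * i' + k, 2 * j' + l) + d * X $$ (2 * i'' + k, 2 * j'' + l)"
    for u w i j i' j' i'' j'' c d
    unfolding F_def sum_distrib_left sum.distrib[symmetric]
    by (intro sum.cong refl, simp only: lessThan_iff that, simp add: distrib_left distrib_right mult_ac)
  have "F Y u 0 0 w = p * G u 0 0 w + q * G u 1 1 w" "F Y u 0 1 w = a * G u 0 1 w + b * G u 1 0 w"
    "F Y u 1 0 w = cnj a * G u 1 0 w + cnj b * G u 0 1 w" "F Y u 1 1 w = p * G u 1 1 w + q * G u 0 0 w" for u w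
    unfolding G_def by (rule lin, simp add: Y_def tensor_id2_def mixing_map_def)+
  then have "herm_form Y v = p * (G v 0 0 v + G (h v) 1 1 (h v)) + q * (G v 1 1 v + G (h v) 0 0 (h v))
      + a * G v 0 1 (h v) + cnj a * G (h v) 1 0 v + b * G v 1 0 (h v) + cnj b * G (h v) 0 1 v" for v
    unfolding H by (simp add: algebra_simps)
  \<comment> \<open>The vectors (v, e h v) and (f h v, v) produce the cross terms with
    \<open>a\<close> and \<open>b\<close>; the vectors with one zero half supply the rest of the
    diagonal terms.\<close>
  then have "herm_form Y v = complex_of_real r * herm_form X (P 1 v e (h v))
      + complex_of_real (p - r) * (herm_form X (P 1 v 0 (h v)) + herm_form X (P 0 v 1 (h v)))
      + complex_of_real s * herm_form X (P f (h v) 1 v)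
      + complex_of_real (q - s) * (herm_form X (P 1 (h v) 0 v) + herm_form X (P 0 (h v) 1 v))"
    if "a = complex_of_real r * e" "b = complex_of_real s * f" for v r s
    unfolding P e(2) f(2) by (simp add: that algebra_simps)
  note this[OF e(1) f(1)]
  moreover have "Im (herm_form X u) = 0" "0 \<le> Re (herm_form X u)" for u
    using X unfolding psd_mat_4_iff by (auto simp: complex_is_Real_iff)
  ultimately have "herm_form Y v \<in> \<real>" "0 \<le> Re (herm_form Y v)" for v
    using assms by (auto simp: complex_is_Real_iff) 
  then show "psd_mat 4 (tensor_id2 (mixing_map p q a b) X)"
    using Y unfolding psd_mat_4_iff Y_def by blast
qed

section \<open>Small determinants and the spectrum of a real 3 x 3 matrix\<close>

lemma det_2: 
  fixes A :: "'a::comm_ring_1 mat"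
  assumes "A \<in> carrier_mat 2 2"
  shows "det A = A $$ (0, 0) * A $$ (1, 1) - A $$ (0, 1) * A $$ (1, 0)"
proof -
  have "det A = (\<Sum>j<2. A $$ (0, j) * cofactor A 0 j)"
    using assms by (intro laplace_expansion_row) auto
  moreover have "mat_delete A i j \<in> carrier_mat 1 1" for i j
    using assms by (auto simp: mat_delete_def)
  ultimately show ?thesis
    using assms by (simp add: cofactor_def det_single numeral_2_eq_2) (simp add: mat_delete_def)
qed

lemma det_3: 
  fixes A :: "'a::comm_ring_1 mat"
  assumes "A \<in> carrier_mat 3 3"
  shows "det A = A $$ (0, 0) * (A $$ (1, 1) * A $$ (2, 2) - A $$ (1, 2) * A $$ (2, 1))
    - A $$ (0, 1) * (A $$ (1, 0) * A $$ (2, 2) - A $$ (1, 2) * A $$ (2, 0))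
    + A $$ (0, 2) * (A $$ (1, 0) * A $$ (2, 1) - A $$ (1, 1) * A $$ (2, 0))"
proof -
  have c: "mat_delete A i j \<in> carrier_mat 2 2" for i j
    using assms by (auto simp: mat_delete_def)
  have "det A = (\<Sum>j<3. A $$ (0, j) * cofactor A 0 j)"
    using assms by (intro laplace_expansion_row) auto
  also have "\<dots> = A $$ (0, 0) * cofactor A 0 0 + A $$ (0, 1) * cofactor A 0 1 + A $$ (0, 2) * cofactor A 0 2"
    by (simp add: eval_nat_numeral)
  also have "cofactor A 0 0 = A $$ (1, 1) * A $$ (2, 2) - A $$ (1, 2) * A $$ (2, 1)"
    unfolding cofactor_def det_2[OF c] using assms by (simp add: mat_delete_def numeral_2_eq_2)
  also have "cofactor A 0 1 = - (A $$ (1, 0) * A $$ (2, 2) - A $$ (1, 2) * A $$ (2, 0))"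
    unfolding cofactor_def det_2[OF c] using assms by (simp add: mat_delete_def numeral_2_eq_2)
  also have "cofactor A 0 2 = A $$ (1, 0) * A $$ (2, 1) - A $$ (1, 1) * A $$ (2, 0)"
    unfolding cofactor_def det_2[OF c] using assms by (simp add: mat_delete_def numeral_2_eq_2)
  finally show ?thesis by (simp add: algebra_simps)
qed

text \<open>Real coefficients will make the spectrum closed under conjugation, and the degree-two
  coefficient fixes the sum of the eigenvalues.\<close>

lemma char_poly_real_3:
  fixes D :: "real mat"
  assumes D: "D \<in> carrier_mat 3 3"
  obtains c0 c1 where "char_poly (map_mat complex_of_real D) =
     [:complex_of_real c0, complex_of_real c1, - complex_of_real (D $$ (0, 0) + D $$ (1, 1) + D $$ (2, 2)), 1:]"
proof -
  let ?C = "char_poly_matrix D"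
  have C: "?C \<in> carrier_mat 3 3" using D by simp
  have ent: "i < 3 \<Longrightarrow> j < 3 \<Longrightarrow> ?C $$ (i, j) = (if i = j then [:- D $$ (i, j), 1:] else [:- D $$ (i, j):])" for i j
    using D by (simp add: char_poly_matrix_def)
  have co: "coeff ([:- a, 1:] * ([:- e, 1:] * [:- i, 1:] - [:- f:] * [:- h:]) - [:- b:] * ([:- d:] * [:- i, 1:] - [:- f:] * [:- g:])
      + [:- c:] * ([:- d:] * [:- h:] - [:- e, 1:] * [:- g:])) 2 = - (a + e + i)" for a b c d e f g h i :: real
    by (simp add: numeral_2_eq_2)
  have "coeff (char_poly D) 2 = - (D $$ (0, 0) + D $$ (1, 1) + D $$ (2, 2))"
    unfolding char_poly_def det_3[OF C]
    by (simp only: ent co rel_simps simp_thms if_True if_False zero_neq_one one_neq_zero)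
  moreover have "degree (char_poly D) = 3" "coeff (char_poly D) 3 = 1"
    using degree_monic_char_poly[OF D] by auto
  moreover have "p = [:coeff p 0, coeff p 1, coeff p 2, coeff p 3:]" if "degree p = 3" for p :: "real poly"
  proof -
    obtain a b c d r where "p = pCons a (pCons b (pCons c (pCons d r)))"
      by (metis pCons_cases)
    moreover from this that have "r = 0" by (auto split: if_splits)
    ultimately show ?thesis by (simp add: eval_nat_numeral)
  qed
  ultimately obtain c0 c1 where "char_poly D = [:c0, c1, - (D $$ (0, 0) + D $$ (1, 1) + D $$ (2, 2)), 1:]"
    by metis
  then have "map_poly complex_of_real (char_poly D) =
     [:complex_of_real c0, complex_of_real c1, - complex_of_real (D $$ (0, 0) + D $$ (1, 1) + D $$ (2, 2)), 1:]"
    by (simp add: map_poly_pCons)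
  then show ?thesis
    using that of_real_hom.char_poly_hom[OF D, where ?'a = complex] by metis
qed

lemma proots_linear_factors: "proots (\<Prod>a\<leftarrow>as. [:- a, 1:]) = mset as" for as :: "'a::idom list"
  by (induction as) (simp_all add: proots_mult prod_list_zero_iff image_iff del: mult_pCons_left)

text \<open>Comparing the factorisation over the complex numbers with the real cubic gives the
  trace. Conjugating the coefficients leaves the cubic unchanged, so the conjugated roots have the
  same multiplicities.\<close>

lemma real_3_spectrum:
  fixes D :: "real mat"
  assumes D: "D \<in> carrier_mat 3 3"
  obtains l1 l2 l3 where
    "proots (char_poly (map_mat complex_of_real D)) = {#l1, l2, l3#}"
    "image_mset cnj {#l1, l2, l3#} = {#l1, l2, l3#}"
    "l1 + l2 + l3 = complex_of_real (D $$ (0, 0) + D $$ (1, 1) + D $$ (2, 2))"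
    "\<And>l. l \<in># {#l1, l2, l3#} \<Longrightarrow> eigenvalue (map_mat complex_of_real D) l"
proof -
  let ?A = "map_mat complex_of_real D"
  have A: "?A \<in> carrier_mat 3 3" using D by simp
  obtain as where as: "char_poly ?A = (\<Prod>a\<leftarrow>as. [:- a, 1:])" "length as = 3"
    using char_poly_factorized[OF A] by blast
  then obtain l1 l2 l3 where l: "as = [l1, l2, l3]"
    by (auto simp: numeral_3_eq_3 length_Suc_conv)
  obtain c0 c1 where cp: "char_poly ?A = [:complex_of_real c0, complex_of_real c1,
      - complex_of_real (D $$ (0, 0) + D $$ (1, 1) + D $$ (2, 2)), 1:]"
    using char_poly_real_3[OF D] .
  have roots: "proots (char_poly ?A) = {#l1, l2, l3#}"
    unfolding as(1) proots_linear_factors l by simp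
  have cubic: "[:- a, 1:] * [:- b, 1:] * [:- c, 1:] = [:- (a * b * c), a * b + a * c + b * c, - (a + b + c), 1:]"
    for a b c :: complex by (simp add: algebra_simps)
  have eq: "[:- l1, 1:] * [:- l2, 1:] * [:- l3, 1:] = [:complex_of_real c0, complex_of_real c1,
      - complex_of_real (D $$ (0, 0) + D $$ (1, 1) + D $$ (2, 2)), 1:]"
    using as(1) cp by (simp add: l mult.assoc del: mult_pCons_left mult_pCons_right)
  then have coeffs: "complex_of_real c0 = - (l1 * l2 * l3)" "complex_of_real c1 = l1 * l2 + l1 * l3 + l2 * l3"
    and tr: "l1 + l2 + l3 = complex_of_real (D $$ (0, 0) + D $$ (1, 1) + D $$ (2, 2))"
    unfolding cubic by (simp_all only: pCons_eq_iff neg_equal_iff_equal)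
  have "[:- cnj l1, 1:] * [:- cnj l2, 1:] * [:- cnj l3, 1:] = char_poly ?A"
    unfolding cp cubic using coeffs[THEN arg_cong, of cnj] tr[THEN arg_cong, of cnj] by simp
  then have "proots (char_poly ?A) = proots (\<Prod>a\<leftarrow>[cnj l1, cnj l2, cnj l3]. [:- a, 1:])"
    by (simp add: mult.assoc del: mult_pCons_left mult_pCons_right)
  then have cl: "image_mset cnj {#l1, l2, l3#} = {#l1, l2, l3#}"
    unfolding proots_linear_factors roots by simp
  have "eigenvalue ?A l" if "l \<in># {#l1, l2, l3#}" for l
  proof -
    have "poly (char_poly ?A) l = 0"
      using that linear_poly_root[of l as] unfolding as(1) l by auto
    then show ?thesis using eigenvalue_root_char_poly[OF A] by blast
  qed
  with that[OF roots cl tr] show ?thesis .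
qed

section \<open>The Bloch matrix of a trace-preserving completely positive map\<close>

text \<open>By the Euler-Rodrigues formula this is |q|^2 + tr(R D) for q = (w, x, y, z), where R is
  the rotation of q scaled by |q|^2.\<close>

definition quaternion_form :: "real mat \<Rightarrow> real \<Rightarrow> real \<Rightarrow> real \<Rightarrow> real \<Rightarrow> real" where
  "quaternion_form D w x y z = w\<^sup>2 + x\<^sup>2 + y\<^sup>2 + z\<^sup>2 + (w\<^sup>2 - x\<^sup>2 - y\<^sup>2 - z\<^sup>2) * (D $$ (0, 0) + D $$ (1, 1) + D $$ (2, 2))
      + 2 * (x * (D $$ (0, 0) * x + D $$ (0, 1) * y + D $$ (0, 2) * z)
        + y * (D $$ (1, 0) * x + D $$ (1, 1) * y + D $$ (1, 2) * z)
        + z * (D $$ (2, 0) * x + D $$ (2, 1) * y + D $$ (2, 2) * z))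
      + 2 * w * (x * (D $$ (1, 2) - D $$ (2, 1)) + y * (D $$ (2, 0) - D $$ (0, 2)) + z * (D $$ (0, 1) - D $$ (1, 0)))"

text \<open>Trace preservation splits off the eigenvalue 1 in the Pauli basis; positivity of the
  Choi matrix gives the inequality for the remaining block.\<close>

lemma trace_preserving_cp_Bloch_matrix:
  fixes T :: "complex mat \<Rightarrow> complex mat"
  defines "m \<equiv> \<lambda>i j. op_matrix T $$ (i, j)"
  assumes cp: "completely_positive T" and tp: "trace_preserving T" and lin: "lin_map_M2 T"
  obtains D :: "real mat" where "D \<in> carrier_mat 3 3"
    "spec_op T = add_mset 1 (proots (char_poly (map_mat complex_of_real D)))"
    "\<And>w x y z. 0 \<le> quaternion_form D w x y z"
proof -
  define C where "C = tensor_id2 T (mat 4 4 (\<lambda>(r, c). if (r = 0 \<or> r = 3) \<and> (c = 0 \<or> c = 3) then 1 else 0))"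
  have C: "psd_mat 4 C"
    using cp psd_maximally_entangled unfolding completely_positive_def C_def by blast
  have ent: "C $$ (2 * k + a, 2 * l + b) = m (2 * k + l) (2 * a + b)" if "k < 2" "l < 2" "a < 2" "b < 2" for k l a b
    using Choi_matrix_entry[OF that] by (simp add: C_def m_def)
  have C_ent: "C $$ (0, 0) = m 0 0" "C $$ (0, 1) = m 0 1" "C $$ (0, 2) = m 1 0" "C $$ (0, 3) = m 1 1"
    "C $$ (1, 0) = m 0 2" "C $$ (1, 1) = m 0 3" "C $$ (1, 2) = m 1 2" "C $$ (1, 3) = m 1 3"
    "C $$ (2, 0) = m 2 0" "C $$ (2, 1) = m 2 1" "C $$ (2, 2) = m 3 0" "C $$ (2, 3) = m 3 1"
    "C $$ (3, 0) = m 2 2" "C $$ (3, 1) = m 2 3" "C $$ (3, 2) = m 3 2" "C $$ (3, 3) = m 3 3"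
    using ent[of 0 0 0 0] ent[of 0 0 0 1] ent[of 0 1 0 0] ent[of 0 1 0 1]
      ent[of 0 0 1 0] ent[of 0 0 1 1] ent[of 0 1 1 0] ent[of 0 1 1 1]
      ent[of 1 0 0 0] ent[of 1 0 0 1] ent[of 1 1 0 0] ent[of 1 1 0 1]
      ent[of 1 0 1 0] ent[of 1 0 1 1] ent[of 1 1 1 0] ent[of 1 1 1 1]
    by simp_all
  \<comment> \<open>Hermiticity of the Choi matrix says that T commutes with taking
    adjoints.\<close>
  have herm: "m 2 0 = cnj (m 1 0)" "m 0 2 = cnj (m 0 1)" "m 2 2 = cnj (m 1 1)" "m 2 1 = cnj (m 1 2)"
    "Im (m 0 0) = 0" "m 2 3 = cnj (m 1 3)" "Im (m 0 3) = 0"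
    using psd_mat_4_herm[OF C, of 0 2] psd_mat_4_herm[OF C, of 0 1] psd_mat_4_herm[OF C, of 0 3]
      psd_mat_4_herm[OF C, of 1 2] psd_mat_4_herm[OF C, of 0 0] psd_mat_4_herm[OF C, of 1 3]
      psd_mat_4_herm[OF C, of 1 1]
    by (simp_all add: C_ent[simplified] complex_eq_iff)
  \<comment> \<open>Trace preservation tested on the matrix units; rows 0 and 3 hold the diagonal
    entries of the images.\<close>
  have "m 0 k + m 3 k = (if k = 0 \<or> k = 3 then 1 else 0)" if "k < 4" for k
  proof -
    have U: "unit_M2 k \<in> carrier_mat 2 2" by (simp add: unit_M2_def)
    then have "T (unit_M2 k) \<in> carrier_mat 2 2" using lin unfolding lin_map_M2_def by blast
    then have "m 0 k + m 3 k = mat_trace (T (unit_M2 k))"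
      using that by (simp add: m_def op_matrix_def mat_trace_def lessThan_nat_numeral lessThan_Suc)
    also have "\<dots> = mat_trace (unit_M2 k)"
      using tp U unfolding trace_preserving_def by blast
    also have "\<dots> = (if k = 0 \<or> k = 3 then 1 else 0)"
    proof -
      have "k = 0 \<or> k = 1 \<or> k = 2 \<or> k = 3" using that by auto
      then show ?thesis
        by (elim disjE) (simp_all add: mat_trace_def unit_M2_def lessThan_nat_numeral lessThan_Suc)
    qed
    finally show ?thesis .
  qed
  from this[of 0] this[of 1] this[of 2] this[of 3] 
  have tr: "m 3 0 = 1 - m 0 0" "m 3 1 = - m 0 1" "m 3 2 = - m 0 2" "m 3 3 = 1 - m 0 3"
    by (simp_all add: algebra_simps eq_neg_iff_add_eq_0)
  define D where "D = mat 3 3 (\<lambda>(i, j). [[Re (m 1 1) + Re (m 1 2), - Im (m 1 1) - Im (m 1 2), 2 * Re (m 0 1)],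
    [Im (m 1 1) - Im (m 1 2), Re (m 1 1) - Re (m 1 2), 2 * Im (m 0 1)],
    [Re (m 1 0) - Re (m 1 3), - Im (m 1 0) + Im (m 1 3), Re (m 0 0) - Re (m 0 3)]] ! i ! j)"
  have D: "D \<in> carrier_mat 3 3" by (simp add: D_def)
  have D_ent: "D $$ (0, 0) = Re (m 1 1) + Re (m 1 2)" "D $$ (0, 1) = - Im (m 1 1) - Im (m 1 2)" "D $$ (0, 2) = 2 * Re (m 0 1)"
    "D $$ (1, 0) = Im (m 1 1) - Im (m 1 2)" "D $$ (1, 1) = Re (m 1 1) - Re (m 1 2)" "D $$ (1, 2) = 2 * Im (m 0 1)"
    "D $$ (2, 0) = Re (m 1 0) - Re (m 1 3)" "D $$ (2, 1) = - Im (m 1 0) + Im (m 1 3)" "D $$ (2, 2) = Re (m 0 0) - Re (m 0 3)"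
    by (simp_all add: D_def numeral_2_eq_2)
  have pos: "0 \<le> quaternion_form D w x y z"
    for w x y z
  proof -
    \<comment> \<open>The entries, row by row, of U = w - \<i>(x \<sigma>1 + y \<sigma>2 + z
      \<sigma>3).\<close>
    let ?v = "\<lambda>i. [Complex w (- z), Complex (- y) (- x), Complex y (- x), Complex w z] ! i"
    have "0 \<le> Re (herm_form C ?v)"
      using C unfolding psd_mat_4_iff by blast
    also have "Re (herm_form C ?v) = quaternion_form D w x y z"
      unfolding quaternion_form_def herm_form_def sum_less_4 One_nat_def[symmetric] C_ent D_ent herm tr
      by (simp add: numeral_2_eq_2 numeral_3_eq_3 herm[unfolded numeral_2_eq_2 numeral_3_eq_3 One_nat_def] algebra_simps power2_eq_square)
    finally show ?thesis .
  qed
  \<comment> \<open>The columns of \<open>P\<close> are the complex conjugates of 1, \<sigma>1,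
    \<sigma>2, \<sigma>3, and \<open>Q\<close> is its inverse. Conjugating the transpose of
    \<open>M\<close> by them gives the transpose of the matrix of T in the Pauli basis.\<close>
  define P where "P = mat 4 4 (\<lambda>(i, j). [[1, 0, 0, 1], [0, 1, \<i>, 0], [0, 1, - \<i>, 0], [1, 0, 0, -1]] ! i ! j :: complex)"
  define Q where "Q = mat 4 4 (\<lambda>(i, j). [[1/2, 0, 0, 1/2], [0, 1/2, 1/2, 0], [0, - \<i>/2, \<i>/2, 0], [1/2, 0, 0, -1/2]] ! i ! j :: complex)"
  define M where "M = op_matrix T"
  have PQ: "P * Q = 1\<^sub>m 4"
    by (rule eq_matI) (auto simp: P_def Q_def scalar_prod_def less_Suc_eq numeral_eq_Suc)
  define N where "N = Q * (transpose_mat M * P)"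
  have car: "P \<in> carrier_mat 4 4" "Q \<in> carrier_mat 4 4" "M \<in> carrier_mat 4 4" "N \<in> carrier_mat 4 4"
    by (auto simp: P_def Q_def M_def N_def op_matrix_def)
  have QP: "Q * P = 1\<^sub>m 4"
    using mat_mult_left_right_inverse[OF car(1,2) PQ] .
  have "transpose_mat M = P * N * Q"
  proof -
    have "P * N * Q = (P * Q) * transpose_mat M * (P * Q)"
      unfolding N_def using car by (simp add: assoc_mult_mat[of _ 4 4 _ 4 _ 4])
    then show ?thesis using car by (simp add: PQ)
  qed
  then have "similar_mat (transpose_mat M) N"
    using car PQ QP unfolding similar_mat_def similar_mat_wit_def Let_def
    by (intro exI[of _ P] exI[of _ Q]) auto
  then have "char_poly M = char_poly N"
    using char_poly_similar char_poly_transpose_mat[OF car(3)] by metis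
  have N_ent: "N $$ (i, j) = (\<Sum>k<4. Q $$ (i, k) * (\<Sum>l<4. m l k * P $$ (l, j)))" if "i < 4" "j < 4" for i j
    using that car unfolding N_def m_def M_def[symmetric]
    by (simp add: scalar_prod_def atLeast0LessThan)
  have P_ent: "P $$ (0, 0) = 1" "P $$ (0, 1) = 0" "P $$ (0, 2) = 0" "P $$ (0, 3) = 1"
    "P $$ (1, 0) = 0" "P $$ (1, 1) = 1" "P $$ (1, 2) = \<i>" "P $$ (1, 3) = 0"
    "P $$ (2, 0) = 0" "P $$ (2, 1) = 1" "P $$ (2, 2) = - \<i>" "P $$ (2, 3) = 0"
    "P $$ (3, 0) = 1" "P $$ (3, 1) = 0" "P $$ (3, 2) = 0" "P $$ (3, 3) = -1"
    by (simp_all add: P_def numeral_2_eq_2 numeral_3_eq_3)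
  have Q_ent: "Q $$ (0, 0) = 1/2" "Q $$ (0, 1) = 0" "Q $$ (0, 2) = 0" "Q $$ (0, 3) = 1/2"
    "Q $$ (1, 0) = 0" "Q $$ (1, 1) = 1/2" "Q $$ (1, 2) = 1/2" "Q $$ (1, 3) = 0"
    "Q $$ (2, 0) = 0" "Q $$ (2, 1) = - \<i>/2" "Q $$ (2, 2) = \<i>/2" "Q $$ (2, 3) = 0"
    "Q $$ (3, 0) = 1/2" "Q $$ (3, 1) = 0" "Q $$ (3, 2) = 0" "Q $$ (3, 3) = -1/2"
    by (simp_all add: Q_def numeral_2_eq_2 numeral_3_eq_3)
  \<comment> \<open>After transposition, trace preservation becomes the first column (1, 0, 0, 0),
    and the image of the identity sits in the first row.\<close>
  let ?B = "four_block_mat (1\<^sub>m 1) (mat 1 3 (\<lambda>(i, j). N $$ (0, j + 1))) (0\<^sub>m 3 1) (map_mat complex_of_real D)"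
  have less_4: "i < 4 \<longleftrightarrow> i = 0 \<or> i = 1 \<or> i = 2 \<or> i = 3" for i :: nat by auto
  have "N = ?B"
  proof (rule eq_matI)
    fix i j assume "i < dim_row ?B" "j < dim_col ?B"
    then have ij: "i < 4" "j < 4" using D by auto
    have col0: "N $$ (i, 0) = (if i = 0 then 1 else 0)"
      using ij(1) unfolding N_ent[OF ij(1) zero_less_numeral] less_4
      by (elim disjE)
        (simp_all add: sum_less_4 One_nat_def[symmetric] P_ent Q_ent herm tr complex_eq_iff del: One_nat_def)
    have row: "N $$ (i, j) = complex_of_real (D $$ (i - 1, j - 1))" if "i > 0" "j > 0"
      using ij that unfolding N_ent[OF ij] less_4
      by (elim disjE)
        (simp_all add: sum_less_4 One_nat_def[symmetric] P_ent Q_ent D_ent herm tr complex_eq_iff field_simps del: One_nat_def)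
    show "N $$ (i, j) = ?B $$ (i, j)"
      using ij D col0 row by (cases "i = 0"; cases "j = 0") (auto simp: index_mat_four_block)
  qed (use car D in auto)
  then have "char_poly N = char_poly ?B" by (rule arg_cong)
  also have "\<dots> = char_poly (1\<^sub>m 1) * char_poly (map_mat complex_of_real D)"
    using D by (intro char_poly_four_block_zeros_col) auto
  also have "char_poly (1\<^sub>m 1 :: complex mat) = [:- 1, 1:]"
    by (simp add: char_poly_defs det_single)
  finally have "spec_op T = proots ([:- 1, 1:] * char_poly (map_mat complex_of_real D))"
    unfolding spec_op_def M_def[symmetric] using \<open>char_poly M = char_poly N\<close> by simp
  also have "\<dots> = add_mset 1 (proots (char_poly (map_mat complex_of_real D)))"
  proof -
    have "char_poly (map_mat complex_of_real D) \<noteq> 0"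
      using degree_monic_char_poly[of "map_mat complex_of_real D" 3] D by auto
    then show ?thesis by (subst proots_mult) auto
  qed
  finally show ?thesis using that D pos by blast
qed

lemma eigenvalue_3_equations:
  fixes D :: "real mat" and l :: complex
  assumes "D \<in> carrier_mat 3 3" "eigenvalue (map_mat complex_of_real D) l"
  obtains x1 x2 x3 :: complex where
    "D $$ (0, 0) * x1 + D $$ (0, 1) * x2 + D $$ (0, 2) * x3 = l * x1"
    "D $$ (1, 0) * x1 + D $$ (1, 1) * x2 + D $$ (1, 2) * x3 = l * x2"
    "D $$ (2, 0) * x1 + D $$ (2, 1) * x2 + D $$ (2, 2) * x3 = l * x3"
    "x1 \<noteq> 0 \<or> x2 \<noteq> 0 \<or> x3 \<noteq> 0"
proof -
  obtain v where v: "v \<in> carrier_vec 3" "v \<noteq> 0\<^sub>v 3" "map_mat complex_of_real D *\<^sub>v v = l \<cdot>\<^sub>v v"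
    using assms unfolding eigenvalue_def eigenvector_def by auto
  have eq: "D $$ (i, 0) * v $ 0 + D $$ (i, 1) * v $ 1 + D $$ (i, 2) * v $ 2 = l * v $ i" if "i < 3" for i
    using arg_cong[OF v(3), of "\<lambda>u. u $ i"] that assms(1) v(1)
    by (simp add: scalar_prod_def atLeast0LessThan eval_nat_numeral)
  have "v $ 0 \<noteq> 0 \<or> v $ 1 \<noteq> 0 \<or> v $ 2 \<noteq> 0"
  proof (rule ccontr)
    assume "\<not> ?thesis"
    then have "v $ i = 0" if "i < 3" for i
      using that by (auto simp: less_Suc_eq numeral_3_eq_3 numeral_2_eq_2)
    then have "v = 0\<^sub>v 3" using v(1) by (intro eq_vecI) auto
    then show False using v(2) by simp
  qed
  with that[OF eq eq eq] show ?thesis by simp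
qed

section \<open>Necessity of the tetrahedron condition\<close>

lemma spectrum_in_tetrahedron:
  assumes "lin_map_M2 T" "completely_positive T" "trace_preserving T"
  shows "\<exists>l1 l2 l3. spec_op T = {#1, l1, l2, l3#} \<and> image_mset cnj {#l1, l2, l3#} = {#l1, l2, l3#}
    \<and> (sval l1, sval l2, sval l3) \<in> tetrahedron"
proof -
  obtain D where D: "D \<in> carrier_mat 3 3"
    and spec: "spec_op T = add_mset 1 (proots (char_poly (map_mat complex_of_real D)))"
    and K: "\<And>w x y z. 0 \<le> quaternion_form D w x y z"
    using trace_preserving_cp_Bloch_matrix[OF assms(2,3,1)] by blast
  define t where "t = D $$ (0, 0) + D $$ (1, 1) + D $$ (2, 2)"
  obtain l1 l2 l3 where roots: "proots (char_poly (map_mat complex_of_real D)) = {#l1, l2, l3#}"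
    and cl: "image_mset cnj {#l1, l2, l3#} = {#l1, l2, l3#}"
    and tr: "l1 + l2 + l3 = complex_of_real t"
    and ev: "\<And>l. l \<in># {#l1, l2, l3#} \<Longrightarrow> eigenvalue (map_mat complex_of_real D) l"
    using real_3_spectrum[OF D] unfolding t_def by blast
  have ineq: "0 \<le> 1 - t + 2 * Re l \<and> (Im l \<noteq> 0 \<longrightarrow> 4 * (Im l)\<^sup>2 \<le> (1 + t) * (1 + t - 4 * Re l))"
    if "l \<in># {#l1, l2, l3#}" for l
    using eigenvalue_3_equations[OF D ev[OF that]] eigenvalue_bounds[OF K[unfolded quaternion_form_def]] unfolding t_def by metis
  have t: "0 \<le> 1 + t" using K[of 1 0 0 0] by (simp add: t_def quaternion_form_def)
  have "(sval l1, sval l2, sval l3) \<in> tetrahedron"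
  proof (cases "\<forall>l \<in># {#l1, l2, l3#}. l \<in> \<real>")
    case True
    then have "sval l1 = Re l1" "sval l2 = Re l2" "sval l3 = Re l3" by (simp_all add: sval_def)
    moreover have "Re l1 + (Re l2 + Re l3) = t"
      using arg_cong[OF tr, of Re] by simp
    ultimately show ?thesis
      using t ineq unfolding tetrahedron_iff_mset by simp
  next
    case False
    then obtain z x where zx: "{#l1, l2, l3#} = {#z, cnj z, complex_of_real x#}" "z \<notin> \<real>"
      using cnj_closed_triple[OF cl] by blast
    have "t = 2 * Re z + x"
      using arg_cong[OF zx(1), of "\<lambda>S. Re (\<Sum>\<^sub># S)"] arg_cong[OF tr, of Re] by simp
    moreover have "0 \<le> 1 - t + 2 * Re z" "4 * (Im z)\<^sup>2 \<le> (1 + t) * (1 + t - 4 * Re z)"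
      using ineq[of z] zx by (auto simp: complex_is_Real_iff)
    moreover have "0 \<le> 1 - t + 2 * x"
      using ineq[of "complex_of_real x"] zx by simp
    \<comment> \<open>Here t = x + 2 Re z, so the bound at z gives x <= 1, while the bound at x
      added to 1 + t >= 0 gives 1 + x >= 0. The quadratic bound is 4|z|^2 <= (1 + x)^2.\<close>
    ultimately have "x \<le> 1" "0 \<le> 1 + x" "4 * (Im z)\<^sup>2 \<le> (1 + x + 2 * Re z) * (1 + x - 2 * Re z)"
      using t by (simp_all add: algebra_simps)
    moreover from this have "(2 * cmod z)\<^sup>2 \<le> (1 + x)\<^sup>2"
      by (simp add: power_mult_distrib cmod_power2) (simp add: algebra_simps power2_eq_square)
    ultimately have "x \<le> 1 \<and> 2 * cmod z \<le> 1 + x"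
      using power2_le_imp_le by blast
    then show ?thesis using sval_pair_tetrahedron_iff[OF zx] by blast
  qed
  then show ?thesis using spec cl unfolding roots by blast
qed

section \<open>Sufficiency of the tetrahedron condition\<close>

text \<open>The diagonal block contributes p + q = 1 and p - q; the off-diagonal block has trace a +
  cnj a and determinant |a|^2 - |b|^2, which the assumptions match by Vieta.\<close>

lemma spec_op_mixing_map:
  assumes "p + q = 1" "l1 + l2 = a + cnj a" "l1 * l2 = a * cnj a - b * cnj b"
  shows "spec_op (mixing_map p q a b) = {#1, l1, l2, p - q#}"
proof -
  define C where "C = char_poly_matrix (op_matrix (mixing_map p q a b))"
  have C: "C = mat 4 4 (\<lambda>(i, j). [[[:- p, 1:], 0, 0, [:- q:]], [0, [:- a, 1:], [:- b:], 0],
     [0, [:- cnj b:], [:- cnj a, 1:], 0], [[:- q:], 0, 0, [:- p, 1:]]] ! i ! j)"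
    (is "_ = ?C")
  proof (rule eq_matI)
    have less_4: "i < 4 \<longleftrightarrow> i = 0 \<or> i = 1 \<or> i = 2 \<or> i = 3" for i :: nat by auto
    fix i j assume "i < dim_row ?C" "j < dim_col ?C"
    then show "C $$ (i, j) = ?C $$ (i, j)"
      unfolding C_def char_poly_matrix_def op_matrix_def dim_row_mat dim_col_mat less_4
      by (elim disjE) (simp_all add: mixing_map_def unit_M2_def)
  qed (simp_all add: C_def char_poly_matrix_def op_matrix_def)
  have carr: "mat_delete C i j \<in> carrier_mat 3 3" for i j
    by (auto simp: mat_delete_def C)
  have "det C = (\<Sum>j<4. C $$ (0, j) * cofactor C 0 j)"
    by (intro laplace_expansion_row) (auto simp: C)
  also have "\<dots> = C $$ (0, 0) * cofactor C 0 0 + C $$ (0, 3) * cofactor C 0 3"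
    by (simp add: sum_less_4 C numeral_2_eq_2)
  also have "\<dots> = ([:- p, 1:] * [:- p, 1:] - [:q:] * [:q:]) * ([:- a, 1:] * [:- cnj a, 1:] - [:b:] * [:cnj b:])"
    unfolding cofactor_def det_3[OF carr]
    by (simp add: mat_delete_def C numeral_2_eq_2 numeral_3_eq_3 del: mult_pCons_left mult_pCons_right)
       (simp add: algebra_simps)
  also have "[:- p, 1:] * [:- p, 1:] - [:q:] * [:q:] = [:- (p + q), 1:] * [:- (p - q), 1:]"
    by (simp add: algebra_simps)
  also have "[:- a, 1:] * [:- cnj a, 1:] - [:b:] * [:cnj b:] = [:a * cnj a - b * cnj b, - (a + cnj a), 1:]"
    by (simp add: algebra_simps)
  also have "\<dots> = [:- l1, 1:] * [:- l2, 1:]"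
    unfolding assms(2,3)[symmetric] by (simp add: algebra_simps)
  finally have "char_poly (op_matrix (mixing_map p q a b)) = (\<Prod>r\<leftarrow>[1, l1, l2, p - q]. [:- r, 1:])"
    unfolding char_poly_def C_def[symmetric] assms(1)
    by (simp add: mult_ac del: mult_pCons_left mult_pCons_right)
  then show ?thesis
    unfolding spec_op_def by (simp only: proots_linear_factors mset.simps)
qed

text \<open>A real eigenvalue x is produced as p - q with p, q = (1 + x)/2, (1 - x)/2; the
  off-diagonal block produces the other two.\<close>

lemma mixing_map_realises:
  assumes cl: "image_mset cnj {#l1, l2, l3#} = {#l1, l2, l3#}"
    and tet: "(sval l1, sval l2, sval l3) \<in> tetrahedron"
  shows "\<exists>T. lin_map_M2 T \<and> unital T \<and> completely_positive T \<and> trace_preserving T \<and> spec_op T = {#1, l1, l2, l3#}"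
proof -
  have realise: "\<exists>T. lin_map_M2 T \<and> unital T \<and> completely_positive T \<and> trace_preserving T
      \<and> spec_op T = {#1, z1, z2, complex_of_real x#}"
    if "cmod a \<le> (1 + x) / 2" "cmod b \<le> (1 - x) / 2" "z1 + z2 = a + cnj a" "z1 * z2 = a * cnj a - b * cnj b"
    for a b z1 z2 x
  proof -
    let ?p = "complex_of_real ((1 + x) / 2)" and ?q = "complex_of_real ((1 - x) / 2)"
    have pq: "?p + ?q = 1" "?p - ?q = complex_of_real x" by (simp_all add: field_simps)
    show ?thesis
      using lin_map_mixing_map unital_mixing_map[OF pq(1)] trace_preserving_mixing_map[OF pq(1)]
        completely_positive_mixing_map[OF that(1,2)] spec_op_mixing_map[OF pq(1) that(3,4)]
      unfolding pq(2) by blast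
  qed
  show ?thesis
  proof (cases "\<forall>l \<in># {#l1, l2, l3#}. l \<in> \<real>")
    case True
    then obtain r1 r2 r3 where r: "l1 = complex_of_real r1" "l2 = complex_of_real r2" "l3 = complex_of_real r3"
      by (auto elim!: Reals_cases)
    have "0 \<le> 1 + r1 + r2 + r3 \<and> 0 \<le> 1 + r1 - r2 - r3 \<and> 0 \<le> 1 - r1 + r2 - r3 \<and> 0 \<le> 1 - r1 - r2 + r3"
      using tet unfolding tetrahedron_iff by (simp add: r sval_def)
    \<comment> \<open>With a = (r1 + r2)/2 and b = (r1 - r2)/2 the block has eigenvalues a + b and a
      - b, and |a| <= p, |b| <= q are together the four faces.\<close>
    then have "\<bar>(r1 + r2) / 2\<bar> \<le> (1 + r3) / 2" "\<bar>(r1 - r2) / 2\<bar> \<le> (1 - r3) / 2"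
      by (auto simp: abs_le_iff field_simps)
    then show ?thesis
      using realise[of "complex_of_real ((r1 + r2) / 2)" r3 "complex_of_real ((r1 - r2) / 2)" l1 l2]
      unfolding r norm_of_real by (simp add: field_simps)
  next
    case False
    then obtain z x where zx: "{#l1, l2, l3#} = {#z, cnj z, complex_of_real x#}" "z \<notin> \<real>"
      using cnj_closed_triple[OF cl] by blast
    then have "x \<le> 1" "2 * cmod z \<le> 1 + x"
      using tet sval_pair_tetrahedron_iff by blast+
    \<comment> \<open>With b = 0 the off-diagonal block is diagonal with entries z and
      \<open>cnj z\<close>.\<close>
    then show ?thesis using realise[of z x 0 z "cnj z"] unfolding zx(1) by simp
  qed
qed

theorem theorem1:
  fixes \<Lambda> :: "complex multiset"
  assumes "size \<Lambda> = 4"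
  shows "((\<exists>T. lin_map_M2 T \<and> completely_positive T \<and> trace_preserving T \<and> spec_op T = \<Lambda>)
          \<longleftrightarrow> (\<exists>T. lin_map_M2 T \<and> unital T \<and> completely_positive T \<and> trace_preserving T
                   \<and> spec_op T = \<Lambda>))
       \<and> ((\<exists>T. lin_map_M2 T \<and> unital T \<and> completely_positive T \<and> trace_preserving T
                   \<and> spec_op T = \<Lambda>)
          \<longleftrightarrow> (\<exists>l1 l2 l3. \<Lambda> = {#1, l1, l2, l3#}
                   \<and> image_mset cnj {#l1, l2, l3#} = {#l1, l2, l3#}
                   \<and> (sval l1, sval l2, sval l3) \<in> tetrahedron))"
  \<comment> \<open>(1) implies (3), (3) implies (2), and (2) is a special case of (1).\<close>
  using spectrum_in_tetrahedron mixing_map_realises by metis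

end
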